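(* Let $A$ and $B$ be positive definite $n\times n$ complex matrices. Then for $p=1$ and $p=2$, $$\|A+B+A\sharp B+A\natural\natural B\|_p\le\|A+B+2(A\natural\natural B)\|_p.$$
   Context: $\|X\|_p=\big(\sum_{i=1}^n s_i(X)^p\big)^{1/p}$ is the Schatten $p$-norm, where $s_1(X)\ge\dots\ge s_n(X)$ are the singular values of $X$. For positive definite $A,B$, the geometric mean is $A\sharp B=A^{\frac12}(A^{-\frac12}BA^{-\frac12})^{\frac12}A^{\frac12}$, and $A\natural\natural B=A^{\frac12}(B^{\frac12}A^{-1}B^{\frac12})^{\frac12}A^{\frac12}$. *)

theory Defs
  imports
    "HOL-Computational_Algebra.Polynomial_Factorial"
    "HOL-Library.Multiset"
    "Jordan_Normal_Form.Schur_Decomposition"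
    "Jordan_Normal_Form.Gauss_Jordan_Elimination"
begin

definition hermitian_mat :: "complex mat \<Rightarrow> bool" where
  "hermitian_mat A \<longleftrightarrow> square_mat A \<and> mat_adjoint A = A"

definition positive_definite :: "complex mat \<Rightarrow> bool" where
  "positive_definite A \<longleftrightarrow> hermitian_mat A \<and>
     (\<forall>v \<in> carrier_vec (dim_row A). v \<noteq> 0\<^sub>v (dim_row A) \<longrightarrow> 0 < Re ((A *\<^sub>v v) \<bullet>c v))"

definition positive_semidefinite :: "complex mat \<Rightarrow> bool" where
  "positive_semidefinite A \<longleftrightarrow> hermitian_mat A \<and>
     (\<forall>v \<in> carrier_vec (dim_row A). 0 \<le> Re ((A *\<^sub>v v) \<bullet>c v))"

(* Meaningful for positive semidefinite A only, where the root exists and is unique. *)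
definition mat_sqrt :: "complex mat \<Rightarrow> complex mat" where
  "mat_sqrt A = (THE S. positive_semidefinite S \<and> S * S = A)"

(* Meaningful for invertible A only. *)
definition mat_inv :: "complex mat \<Rightarrow> complex mat" where
  "mat_inv A = the (mat_inverse A)"

definition geometric_mean :: "complex mat \<Rightarrow> complex mat \<Rightarrow> complex mat" (infixl \<open>\<sharp>\<close> 70) where
  "A \<sharp> B = mat_sqrt A * mat_sqrt (mat_inv (mat_sqrt A) * B * mat_inv (mat_sqrt A)) * mat_sqrt A"

definition double_natural_mean :: "complex mat \<Rightarrow> complex mat \<Rightarrow> complex mat"
    (infixl \<open>\<natural>\<natural>\<close> 70) where
  "A \<natural>\<natural> B = mat_sqrt A * mat_sqrt (mat_sqrt B * mat_inv A * mat_sqrt B) * mat_sqrt A"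

(* The square roots of the eigenvalues of X^* X, repeated according to algebraic multiplicity
   (as roots of the characteristic polynomial) and listed in decreasing order.  The eigenvalues
   are nonnegative reals, so taking Re loses nothing. *)
definition singular_values :: "complex mat \<Rightarrow> real list" where
  "singular_values X = rev (sorted_list_of_multiset
     (image_mset (\<lambda>z. sqrt (Re z)) (proots (char_poly (mat_adjoint X * X)))))"

definition schatten_norm :: "real \<Rightarrow> complex mat \<Rightarrow> real" where
  "schatten_norm p X = (\<Sum>s \<leftarrow> singular_values X. s powr p) powr (1 / p)"

end

theory Submission
  imports Defs
begin

text \<open>Put \<open>D = B\<^sup>1\<^sup>/\<^sup>2\<close>, \<open>F = A\<^sup>1\<^sup>/\<^sup>2\<close>, let \<open>C = (D A\<^sup>-\<^sup>1 D)\<^sup>1\<^sup>/\<^sup>2\<close> be the root inside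
\<open>N = A \<natural>\<natural> B = F C F\<close>, and let \<open>X = C\<^sup>-\<^sup>1\<close>. Then \<open>A = D X\<^sup>2 D\<close>, and the geometric mean loses all
its roots: \<open>G = A \<sharp> B = D X D\<close>. As \<open>F\<^sup>2 = D X\<^sup>2 D = (X D)\<^sup>* (X D)\<close>, the polar decomposition of
\<open>X D\<close> is \<open>X D = W F\<close> with \<open>W\<close> unitary.

All matrices that occur are positive definite, so the norm for \<open>p = 1\<close> is the trace and the norm for
\<open>p = 2\<close> is \<open>(tr M\<^sup>2)\<^sup>1\<^sup>/\<^sup>2\<close>. With \<open>M = A + B + G + N\<close> and \<open>E = N - G\<close> the two sides are the norms of
\<open>M\<close> and \<open>M + E\<close>. For \<open>p = 1\<close> the claim is \<open>tr G \<le> tr N\<close>. For \<open>p = 2\<close> it follows from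
\<open>tr (M + E)\<^sup>2 = tr M\<^sup>2 + 2 tr (M E) + tr E\<^sup>2\<close> once \<open>tr (M E) \<ge> 0\<close>, and this splits into
\<open>tr (A G) \<le> tr (A N)\<close>, \<open>tr (B G) \<le> tr (B N)\<close> and \<open>tr G\<^sup>2 \<le> tr N\<^sup>2\<close>, the mixed traces of \<open>G\<close> and \<open>N\<close>
cancelling.

The four trace inequalities all come from one weighted arithmetic-geometric mean inequality,
\<open>2 Re tr (Q M P N\<^sup>*) \<le> Re tr (Q M P M\<^sup>*) + Re tr (Q N P N\<^sup>*)\<close> for positive definite \<open>Q\<close> and \<open>P\<close>
(\<open>re_trace_weighted_AM_GM\<close>), used with words in \<open>D\<close>, \<open>X\<close>, \<open>C\<close>, \<open>F\<close>, \<open>W\<close>. The inequality for \<open>B\<close> is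
the only one in which \<open>W\<close> cannot be avoided. It passes through \<open>tr (B G) \<le> tr (D\<^sup>3 F)\<close>
(\<open>trace_mult_polar_le\<close>), which holds because both sides are consecutive terms of a convex sequence
that is eventually nonincreasing.\<close>

section \<open>Adjoints, traces and unitary matrices\<close>

text \<open>In the square case the inner dimension of a product is determined by the goal, which makes these
instances usable as rewrite rules.\<close>

lemma square_mult_carrier [simp]:
  "A \<in> carrier_mat n n \<Longrightarrow> B \<in> carrier_mat n n \<Longrightarrow> A * B \<in> carrier_mat n n"
  by (rule mult_carrier_mat)

lemma square_mult_one [simp]:
  fixes A :: "'a :: semiring_1 mat"
  assumes "A \<in> carrier_mat n n"
  shows "1\<^sub>m n * A = A" "A * 1\<^sub>m n = A"
  using assms by auto

lemma mat_adjoint_carrier [simp, intro]: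
  "A \<in> carrier_mat n m \<Longrightarrow> mat_adjoint A \<in> carrier_mat m n"
  by (auto simp: mat_adjoint_def)

lemma mat_adjoint_index [simp]:
  fixes A :: "complex mat"
  assumes "i < dim_col A" "j < dim_row A"
  shows "mat_adjoint A $$ (i, j) = cnj (A $$ (j, i))"
  using assms by (simp add: mat_adjoint_def mat_of_rows_index)

lemma mat_adjoint_dims [simp]:
  "dim_row (mat_adjoint A) = dim_col A" "dim_col (mat_adjoint A) = dim_row A"
  by (auto simp: mat_adjoint_def)

lemma mat_adjoint_mat_adjoint [simp]:
  fixes A :: "complex mat"
  shows "mat_adjoint (mat_adjoint A) = A"
  by (rule eq_matI) auto

lemma mat_adjoint_one [simp]: "mat_adjoint (1\<^sub>m n :: complex mat) = 1\<^sub>m n"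
  by (rule eq_matI) auto

lemma mat_adjoint_add:
  fixes A B :: "complex mat"
  assumes "A \<in> carrier_mat n m" "B \<in> carrier_mat n m"
  shows "mat_adjoint (A + B) = mat_adjoint A + mat_adjoint B"
  using assms by (intro eq_matI) auto

lemma mat_adjoint_minus:
  fixes A B :: "complex mat"
  assumes "A \<in> carrier_mat n m" "B \<in> carrier_mat n m"
  shows "mat_adjoint (A - B) = mat_adjoint A - mat_adjoint B"
  using assms by (intro eq_matI) auto

lemma mat_adjoint_mult:
  fixes A B :: "complex mat"
  assumes "A \<in> carrier_mat n m" "B \<in> carrier_mat m k"
  shows "mat_adjoint (A * B) = mat_adjoint B * mat_adjoint A"
  using assms
  by (intro eq_matI) (auto simp: scalar_prod_def mult.commute intro!: sum.cong)

lemma mat_adjoint_four_block: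
  fixes A B C D :: "complex mat"
  assumes "A \<in> carrier_mat n1 m1" "B \<in> carrier_mat n1 m2" "C \<in> carrier_mat n2 m1" "D \<in> carrier_mat n2 m2"
  shows "mat_adjoint (four_block_mat A B C D)
    = four_block_mat (mat_adjoint A) (mat_adjoint C) (mat_adjoint B) (mat_adjoint D)"
  using assms by (intro eq_matI) (auto simp: four_block_mat_def Let_def)

definition mat_trace :: "complex mat \<Rightarrow> complex" where
  "mat_trace A = (\<Sum>i<dim_row A. A $$ (i, i))"

lemma mat_trace_comm:
  assumes "A \<in> carrier_mat n m" "B \<in> carrier_mat m n"
  shows "mat_trace (A * B) = mat_trace (B * A)"
proof -
  have "mat_trace (A * B) = (\<Sum>i<n. \<Sum>j<m. A $$ (i,j) * B $$ (j,i))"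
    using assms by (simp add: mat_trace_def scalar_prod_def lessThan_atLeast0)
  also have "\<dots> = (\<Sum>j<m. \<Sum>i<n. A $$ (i,j) * B $$ (j,i))" by (rule sum.swap)
  also have "\<dots> = mat_trace (B * A)"
    using assms by (simp add: mat_trace_def scalar_prod_def lessThan_atLeast0 mult.commute)
  finally show ?thesis .
qed

lemma mat_trace_add:
  assumes "A \<in> carrier_mat n n" "B \<in> carrier_mat n n"
  shows "mat_trace (A + B) = mat_trace A + mat_trace B"
  using assms by (simp add: mat_trace_def sum.distrib)

lemma mat_trace_minus:
  assumes "A \<in> carrier_mat n n" "B \<in> carrier_mat n n"
  shows "mat_trace (A - B) = mat_trace A - mat_trace B"
  using assms by (simp add: mat_trace_def sum_subtractf)

lemma mat_trace_adjoint:
  assumes "A \<in> carrier_mat n n"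
  shows "mat_trace (mat_adjoint A) = cnj (mat_trace A)"
  using assms by (simp add: mat_trace_def)

definition real_diag :: "nat \<Rightarrow> (nat \<Rightarrow> real) \<Rightarrow> complex mat" where
  "real_diag n d = mat n n (\<lambda>(i, j). if i = j then complex_of_real (d i) else 0)"

lemma real_diag_carrier [simp]: "real_diag n d \<in> carrier_mat n n"
  by (simp add: real_diag_def)

lemma real_diag_mult: "real_diag n d * real_diag n e = real_diag n (\<lambda>i. d i * e i)"
proof (rule eq_matI)
  fix i j assume ij: "i < dim_row (real_diag n (\<lambda>i. d i * e i))" "j < dim_col (real_diag n (\<lambda>i. d i * e i))"
  then have "(real_diag n d * real_diag n e) $$ (i, j) = (\<Sum>k\<in>{0..<n}.
      (if i = k then complex_of_real (d i) else 0) * (if k = j then complex_of_real (e k) else 0))"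
    by (simp add: real_diag_def scalar_prod_def)
  also have "\<dots> = (\<Sum>k\<in>{0..<n}. if k = i then (if i = j then complex_of_real (d i * e i) else 0) else 0)"
    by (intro sum.cong) auto
  also have "\<dots> = real_diag n (\<lambda>i. d i * e i) $$ (i, j)"
    using ij by (simp add: real_diag_def)
  finally show "(real_diag n d * real_diag n e) $$ (i, j) = real_diag n (\<lambda>i. d i * e i) $$ (i, j)" .
qed (auto simp: real_diag_def)

lemma real_diag_one: "(\<And>i. i < n \<Longrightarrow> d i = 1) \<Longrightarrow> real_diag n d = 1\<^sub>m n"
  by (rule eq_matI) (auto simp: real_diag_def)

lemma mat_adjoint_real_diag [simp]: "mat_adjoint (real_diag n d) = real_diag n d"
  by (rule eq_matI) (auto simp: real_diag_def)

definition unitary :: "nat \<Rightarrow> complex mat \<Rightarrow> bool" where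
  "unitary n U \<longleftrightarrow> U \<in> carrier_mat n n \<and> mat_adjoint U * U = 1\<^sub>m n \<and> U * mat_adjoint U = 1\<^sub>m n"

lemma unitaryI:
  assumes "U \<in> carrier_mat n n" "mat_adjoint U * U = 1\<^sub>m n"
  shows "unitary n U"
  using assms mat_mult_left_right_inverse[of "mat_adjoint U" n U] by (auto simp: unitary_def)

lemma unitary_mult:
  assumes "unitary n U" "unitary n V"
  shows "unitary n (U * V)"
proof (rule unitaryI)
  have c: "U \<in> carrier_mat n n" "V \<in> carrier_mat n n" using assms by (auto simp: unitary_def)
  then show "U * V \<in> carrier_mat n n" by simp
  have "mat_adjoint (U * V) * (U * V) = mat_adjoint V * ((mat_adjoint U * U) * V)"
    using c by (simp add: mat_adjoint_mult[of _ n n _ n] assoc_mult_mat[of _ n n _ n _ n])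
  also have "\<dots> = 1\<^sub>m n" using assms c by (simp add: unitary_def)
  finally show "mat_adjoint (U * V) * (U * V) = 1\<^sub>m n" .
qed

section \<open>The spectral theorem for Hermitian matrices\<close>

lemma ex_eigenvector:
  fixes A :: "complex mat"
  assumes A: "A \<in> carrier_mat (Suc n) (Suc n)"
  shows "\<exists>v e. v \<in> carrier_vec (Suc n) \<and> v \<noteq> 0\<^sub>v (Suc n) \<and> A *\<^sub>v v = e \<cdot>\<^sub>v v"
proof -
  have "degree (char_poly A) = Suc n" using degree_monic_char_poly[OF A] by simp
  then have "\<not> constant (poly (char_poly A))" by (simp add: constant_degree)
  then obtain e where "poly (char_poly A) e = 0" using fundamental_theorem_of_algebra by blast
  then have "eigenvalue A e" using eigenvalue_root_char_poly[OF A] by simp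
  then show ?thesis using A unfolding eigenvalue_def eigenvector_def by auto
qed

lemma cscalar_self_real:
  fixes v :: "complex vec"
  assumes "v \<in> carrier_vec n"
  shows "v \<bullet>c v = complex_of_real (\<Sum>i<n. (cmod (v $ i))\<^sup>2)"
  using assms
  by (simp add: scalar_prod_def lessThan_atLeast0 complex_norm_square del: of_real_power)

lemma cscalar_self_pos:
  fixes v :: "complex vec"
  assumes "v \<in> carrier_vec n" "v \<noteq> 0\<^sub>v n"
  shows "0 < Re (v \<bullet>c v)"
proof -
  obtain i where "i < n" "v $ i \<noteq> 0" using assms by (metis carrier_vecD eq_vecI index_zero_vec)
  then have "0 < (\<Sum>i<n. (cmod (v $ i))\<^sup>2)" by (intro sum_pos2[of _ i]) auto
  then show ?thesis using cscalar_self_real[OF assms(1)] by simp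
qed

text \<open>The deflation step: an eigenvector is completed to an orthogonal basis by Gram-Schmidt, and
normalising that basis makes the change of coordinates unitary, so that it preserves Hermitian
matrices.\<close>

lemma ex_unitary_first_column:
  fixes A :: "complex mat"
  assumes A: "A \<in> carrier_mat (Suc n) (Suc n)"
  shows "\<exists>W e. unitary (Suc n) W \<and>
     col (mat_adjoint W * A * W) 0 = vec (Suc n) (\<lambda>i. if i = 0 then e else 0)"
proof -
  let ?m = "Suc n"
  obtain v e where v: "v \<in> carrier_vec ?m" and v0: "v \<noteq> 0\<^sub>v ?m" and ev: "A *\<^sub>v v = e \<cdot>\<^sub>v v"
    using ex_eigenvector[OF A] by auto
  interpret cof_vec_space ?m "TYPE(complex)" .
  define b where "b = basis_completion v"
  define us where "us = gram_schmidt ?m b"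
  from basis_completion[OF v v0, folded b_def]
  have dist_b: "distinct b" and indep: "\<not> lin_dep (set b)" and b: "set b \<subseteq> carrier_vec ?m"
    and hdb: "hd b = v" and len_b: "length b = ?m" by auto
  from hdb len_b obtain vs where bv: "b = v # vs" by (cases b) auto
  from gram_schmidt_result[OF b dist_b indep refl, folded us_def]
  have us: "set us \<subseteq> carrier_vec ?m" "corthogonal us" "length us = ?m" by (auto simp: len_b)
  from gram_schmidt_hd[OF v, of vs, folded bv] have hdus: "hd us = v" unfolding us_def .
  define s where "s w = complex_of_real (1 / sqrt (Re (w \<bullet>c w)))" for w :: "complex vec"
  define ws where "ws = map (\<lambda>w. s w \<cdot>\<^sub>v w) us"
  have usi: "us ! i \<in> carrier_vec ?m" if "i < ?m" for i using us that by (metis nth_mem subsetD)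
  have wsi: "ws ! i = s (us ! i) \<cdot>\<^sub>v (us ! i)" if "i < ?m" for i using us that by (simp add: ws_def)
  have sp: "(ws ! i) \<bullet>c (ws ! j) = s (us ! i) * s (us ! j) * ((us ! i) \<bullet>c (us ! j))"
    if "i < ?m" "j < ?m" for i j
    using usi[OF that(1)] usi[OF that(2)] that
    by (simp add: wsi conjugate_smult_vec s_def)
  have unit: "(ws ! i) \<bullet>c (ws ! i) = 1" if i: "i < ?m" for i
  proof -
    have "us ! i \<bullet>c us ! i \<noteq> 0" using corthogonalD[OF us(2), of i i] us(3) i by auto
    then have "us ! i \<noteq> 0\<^sub>v ?m" by auto
    then have p: "0 < Re (us ! i \<bullet>c us ! i)" using cscalar_self_pos[OF usi[OF i]] by simp
    have r: "us ! i \<bullet>c us ! i = complex_of_real (Re (us ! i \<bullet>c us ! i))"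
      using cscalar_self_real[OF usi[OF i]] by simp
    have "s (us ! i) * s (us ! i) * (us ! i \<bullet>c us ! i)
      = complex_of_real (1 / sqrt (Re (us ! i \<bullet>c us ! i)) * (1 / sqrt (Re (us ! i \<bullet>c us ! i))) * Re (us ! i \<bullet>c us ! i))"
      by (subst r) (simp only: s_def of_real_mult)
    also have "\<dots> = complex_of_real 1"
      using p real_sqrt_mult_self[of "Re (us ! i \<bullet>c us ! i)"] by (intro arg_cong[of _ _ complex_of_real]) (simp add: field_simps)
    finally show ?thesis using sp[OF i i] by simp
  qed
  have orth: "(ws ! i) \<bullet>c (ws ! j) = 0" if "i < ?m" "j < ?m" "i \<noteq> j" for i j
    using sp[OF that(1,2)] corthogonalD[OF us(2), of i j] us(3) that by simp
  have len: "length ws = ?m" using us by (simp add: ws_def)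
  have ws: "set ws \<subseteq> carrier_vec ?m" "corthogonal ws"
    using us(1) apply (auto simp: ws_def)[1]
    using unit orth len by (intro corthogonalI) fastforce
  have hdws: "hd ws = s v \<cdot>\<^sub>v v" using hdus us by (cases us) (auto simp: ws_def)
  have wc: "ws ! i \<in> carrier_vec ?m" if "i < ?m" for i using ws len that by (metis nth_mem subsetD)
  define W where "W = mat_of_cols ?m ws"
  have W: "W \<in> carrier_mat ?m ?m" using len unfolding W_def by auto
  have WW: "mat_adjoint W * W = 1\<^sub>m ?m"
  proof (rule eq_matI)
    fix i j assume ij: "i < dim_row (1\<^sub>m ?m :: complex mat)" "j < dim_col (1\<^sub>m ?m :: complex mat)"
    have "(mat_adjoint W * W) $$ (i, j) = (ws ! j) \<bullet>c (ws ! i)"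
      using ij W wc[of i] wc[of j] len
      by (auto simp: scalar_prod_def W_def mat_of_cols_index mult.commute intro!: sum.cong)
    then show "(mat_adjoint W * W) $$ (i, j) = 1\<^sub>m ?m $$ (i, j)"
      using unit orth ij by auto
  qed (use W in auto)
  have inv: "corthogonal_inv W = mat_adjoint W"
  proof -
    have "vec_inv w = conjugate w" if w: "w \<in> set ws" for w
    proof -
      obtain i where "i < ?m" "w = ws ! i" using w len unfolding in_set_conv_nth by auto
      then show ?thesis using unit[of i] by (simp add: vec_inv_def)
    qed
    moreover have "cols W = ws" unfolding W_def using cols_mat_of_cols[OF ws(1)] by simp
    ultimately show ?thesis unfolding corthogonal_inv_def mat_adjoint_def by (auto cong: map_cong)
  qed
  have ev': "A *\<^sub>v (s v \<cdot>\<^sub>v v) = e \<cdot>\<^sub>v (s v \<cdot>\<^sub>v v)"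
    using ev mult_mat_vec[OF A v] by (simp add: smult_smult_assoc mult.commute)
  have s0: "s v \<cdot>\<^sub>v v \<noteq> 0\<^sub>v ?m"
  proof -
    have "s v \<noteq> 0" using cscalar_self_pos[OF v v0] by (simp add: s_def)
    moreover obtain i where "i < ?m" "v $ i \<noteq> 0"
      using v v0 by (metis carrier_vecD eq_vecI index_zero_vec)
    ultimately have "(s v \<cdot>\<^sub>v v) $ i \<noteq> 0\<^sub>v ?m $ i" using v by simp
    then show ?thesis by metis
  qed
  have "col (mat_adjoint W * A * W) 0 = vec ?m (\<lambda>i. if i = 0 then e else 0)"
    using corthogonal_col_ev_0[OF A _ s0 ev' _ hdws ws len] v inv unfolding W_def by simp
  with unitaryI[OF W WW] show ?thesis by auto
qed

text \<open>After deflation the first column of the Hermitian matrix \<open>W\<^sup>* A W\<close> is a multiple of the first unit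
vector, hence so is the first row, the corner entry is real, and the induction hypothesis applies
to the remaining block.\<close>

lemma hermitian_spectral:
  fixes A :: "complex mat"
  assumes "A \<in> carrier_mat n n" "mat_adjoint A = A"
  shows "\<exists>U d. unitary n U \<and> A = U * real_diag n d * mat_adjoint U"
  using assms
proof (induction n arbitrary: A)
  case 0
  then have "unitary 0 A" "A = A * real_diag 0 (\<lambda>_. 0) * mat_adjoint A"
    by (auto simp: unitary_def real_diag_def intro!: eq_matI)
  then show ?case by blast
next
  case (Suc n)
  let ?m = "Suc n"
  note A = Suc.prems(1)
  obtain W e where W: "unitary ?m W"
    and col: "col (mat_adjoint W * A * W) 0 = vec ?m (\<lambda>i. if i = 0 then e else 0)"
    using ex_unitary_first_column[OF A] by auto
  have Wc: "W \<in> carrier_mat ?m ?m" using W by (simp add: unitary_def)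
  define H where "H = mat_adjoint W * A * W"
  have H: "H \<in> carrier_mat ?m ?m" using Wc A by (simp add: H_def)
  have Hh: "mat_adjoint H = H"
    using Wc A Suc.prems(2)
    by (simp add: H_def mat_adjoint_mult[of _ ?m ?m _ ?m] assoc_mult_mat[of _ ?m ?m _ ?m _ ?m])
  have hij: "cnj (H $$ (j, i)) = H $$ (i, j)" if "i < ?m" "j < ?m" for i j
    using Hh H that mat_adjoint_index[of i H j] by simp
  have h0: "H $$ (i, 0) = (if i = 0 then e else 0)" if "i < ?m" for i
    using arg_cong[OF col, of "\<lambda>v. v $ i"] H that by (simp flip: H_def)
  have e: "e = complex_of_real (Re e)"
    using h0[of 0] hij[of 0 0] by (simp add: complex_eq_iff)
  define H3 where "H3 = mat n n (\<lambda>(i, j). H $$ (Suc i, Suc j))"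
  have H3: "H3 \<in> carrier_mat n n" by (simp add: H3_def)
  have H3h: "mat_adjoint H3 = H3"
    by (intro eq_matI) (auto simp: H3_def hij)
  obtain V d where V: "unitary n V" and HV: "H3 = V * real_diag n d * mat_adjoint V"
    using Suc.IH[OF H3 H3h] by auto
  have Vc: "V \<in> carrier_mat n n" using V by (simp add: unitary_def)
  define blk :: "complex mat \<Rightarrow> complex mat \<Rightarrow> complex mat"
    where "blk a b = four_block_mat a (0\<^sub>m 1 n) (0\<^sub>m n 1) b" for a b
  have blk_mult: "blk a b * blk c d' = blk (a * c) (b * d')"
    if "a \<in> carrier_mat 1 1" "b \<in> carrier_mat n n" "c \<in> carrier_mat 1 1" "d' \<in> carrier_mat n n"
    for a b c d'
    using that unfolding blk_def by (subst mult_four_block_mat[of _ 1 1 _ n _ n _ _ 1 _ n]) auto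
  have z: "mat_adjoint (0\<^sub>m a b :: complex mat) = 0\<^sub>m b a" for a b by (rule eq_matI) auto
  have blk_adj: "mat_adjoint (blk a b) = blk (mat_adjoint a) (mat_adjoint b)"
    if "a \<in> carrier_mat 1 1" "b \<in> carrier_mat n n" for a b
    using that unfolding blk_def by (subst mat_adjoint_four_block[of _ 1 1 _ n _ n]) (auto simp: z)
  have Hblk: "H = blk (real_diag 1 (\<lambda>_. Re e)) H3"
  proof (rule eq_matI)
    fix i j assume "i < dim_row (blk (real_diag 1 (\<lambda>_. Re e)) H3)"
      "j < dim_col (blk (real_diag 1 (\<lambda>_. Re e)) H3)"
    then have ij: "i < ?m" "j < ?m" by (auto simp: H3_def real_diag_def blk_def)
    show "H $$ (i, j) = blk (real_diag 1 (\<lambda>_. Re e)) H3 $$ (i, j)"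
      using ij e h0[of i] h0[of j] hij[of i j]
      by (auto simp: four_block_mat_def Let_def H3_def real_diag_def blk_def)
  qed (use H in \<open>auto simp: H3_def real_diag_def blk_def\<close>)
  define V' where "V' = blk (1\<^sub>m 1) V"
  have V'c: "V' \<in> carrier_mat ?m ?m" using Vc by (auto simp: V'_def blk_def)
  have one: "blk (1\<^sub>m 1) (1\<^sub>m n) = 1\<^sub>m ?m" by (rule eq_matI) (auto simp: blk_def)
  have "mat_adjoint V' * V' = blk (1\<^sub>m 1) (mat_adjoint V * V)"
    using Vc by (simp add: V'_def blk_adj blk_mult)
  then have V': "unitary ?m V'" using V one V'c by (intro unitaryI) (auto simp: unitary_def)
  define d' where "d' i = (case i of 0 \<Rightarrow> Re e | Suc k \<Rightarrow> d k)" for i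
  have diag: "real_diag ?m d' = blk (real_diag 1 (\<lambda>_. Re e)) (real_diag n d)"
    by (rule eq_matI) (auto simp: blk_def real_diag_def d'_def four_block_mat_def Let_def split: nat.splits)
  have VH: "V' * real_diag ?m d' * mat_adjoint V' = H"
    using Vc by (simp add: V'_def diag blk_adj blk_mult Hblk HV)
  then have "W * V' * real_diag ?m d' * mat_adjoint (W * V') = W * H * mat_adjoint W"
    using Wc V'c by (simp add: mat_adjoint_mult[of _ ?m ?m _ ?m] assoc_mult_mat[of _ ?m ?m _ ?m _ ?m] flip: VH)
  also have "\<dots> = (W * mat_adjoint W) * A * (W * mat_adjoint W)"
    using Wc A by (simp add: H_def assoc_mult_mat[of _ ?m ?m _ ?m _ ?m])
  also have "\<dots> = A" using W A by (simp add: unitary_def)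
  finally have "A = W * V' * real_diag ?m d' * mat_adjoint (W * V')" ..
  then show ?case using unitary_mult[OF W V'] by blast
qed

section \<open>Positive definite matrices, their inverses and roots\<close>

lemma hermitian_form_congruence:
  fixes P M :: "complex mat"
  assumes "P \<in> carrier_mat n n" "M \<in> carrier_mat n m" "v \<in> carrier_vec m"
  shows "(mat_adjoint M * P * M *\<^sub>v v) \<bullet>c v = (P *\<^sub>v (M *\<^sub>v v)) \<bullet>c (M *\<^sub>v v)"
proof -
  have adj: "(mat_adjoint M *\<^sub>v u) \<bullet>c v = u \<bullet>c (M *\<^sub>v v)" if u: "u \<in> carrier_vec n" for u
  proof -
    have "(mat_adjoint M *\<^sub>v u) \<bullet>c v = (\<Sum>i<m. \<Sum>j<n. cnj (M $$ (j, i)) * u $ j * cnj (v $ i))"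
      using assms u by (simp add: scalar_prod_def lessThan_atLeast0 sum_distrib_right)
    also have "\<dots> = (\<Sum>j<n. \<Sum>i<m. cnj (M $$ (j, i)) * u $ j * cnj (v $ i))" by (rule sum.swap)
    also have "\<dots> = u \<bullet>c (M *\<^sub>v v)"
      using assms u by (simp add: scalar_prod_def lessThan_atLeast0 sum_distrib_left mult_ac)
    finally show ?thesis .
  qed
  have "mat_adjoint M * P * M *\<^sub>v v = mat_adjoint M * P *\<^sub>v (M *\<^sub>v v)"
    using assms by (intro assoc_mult_mat_vec[of _ m n _ m]) auto
  also have "\<dots> = mat_adjoint M *\<^sub>v (P *\<^sub>v (M *\<^sub>v v))"
    using assms by (intro assoc_mult_mat_vec[of _ m n _ n]) auto
  finally have "mat_adjoint M * P * M *\<^sub>v v = mat_adjoint M *\<^sub>v (P *\<^sub>v (M *\<^sub>v v))" .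
  then show ?thesis using adj assms by simp
qed

lemma positive_definiteI:
  assumes "A \<in> carrier_mat n n" "mat_adjoint A = A"
    "\<And>v. v \<in> carrier_vec n \<Longrightarrow> v \<noteq> 0\<^sub>v n \<Longrightarrow> 0 < Re ((A *\<^sub>v v) \<bullet>c v)"
  shows "positive_definite A"
  using assms by (auto simp: positive_definite_def hermitian_mat_def)

lemma positive_definite_adjoint: "positive_definite A \<Longrightarrow> mat_adjoint A = A"
  by (simp add: positive_definite_def hermitian_mat_def)

lemma positive_definite_pos:
  "positive_definite A \<Longrightarrow> A \<in> carrier_mat n n \<Longrightarrow> v \<in> carrier_vec n \<Longrightarrow> v \<noteq> 0\<^sub>v n
    \<Longrightarrow> 0 < Re ((A *\<^sub>v v) \<bullet>c v)"
  by (auto simp: positive_definite_def)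

lemma positive_definite_nonneg:
  assumes "positive_definite A" "A \<in> carrier_mat n n" "v \<in> carrier_vec n"
  shows "0 \<le> Re ((A *\<^sub>v v) \<bullet>c v)"
proof (cases "v = 0\<^sub>v n")
  case False
  then show ?thesis using positive_definite_pos[OF assms] by simp
next
  case True
  moreover have "A *\<^sub>v 0\<^sub>v n = 0\<^sub>v n" using assms(2) by (intro eq_vecI) auto
  ultimately show ?thesis by simp
qed

lemma mult_mat_vec_nonzero:
  fixes M L :: "complex mat"
  assumes "M \<in> carrier_mat n n" "L \<in> carrier_mat n n" "L * M = 1\<^sub>m n" "v \<in> carrier_vec n" "v \<noteq> 0\<^sub>v n"
  shows "M *\<^sub>v v \<noteq> 0\<^sub>v n"
proof
  assume "M *\<^sub>v v = 0\<^sub>v n"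
  then have "(L * M) *\<^sub>v v = L *\<^sub>v 0\<^sub>v n" using assoc_mult_mat_vec[OF assms(2,1,4)] by simp
  moreover have "L *\<^sub>v 0\<^sub>v n = 0\<^sub>v n" using assms(2) by (intro eq_vecI) auto
  ultimately show False using assms by simp
qed

text \<open>The left inverse \<open>L\<close> stands for injectivity of \<open>M\<close>; wherever the lemma is used it is known explicitly.\<close>

lemma positive_definite_congruence:
  assumes "P \<in> carrier_mat n n" "M \<in> carrier_mat n n" "L \<in> carrier_mat n n" "L * M = 1\<^sub>m n"
    "positive_definite P"
  shows "positive_definite (mat_adjoint M * P * M)"
proof (rule positive_definiteI[where n = n])
  show "mat_adjoint (mat_adjoint M * P * M) = mat_adjoint M * P * M"
    using assms positive_definite_adjoint[OF assms(5)]
    by (simp add: mat_adjoint_mult[of _ n n _ n] assoc_mult_mat[of _ n n _ n _ n])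
  show "0 < Re ((mat_adjoint M * P * M *\<^sub>v v) \<bullet>c v)" if "v \<in> carrier_vec n" "v \<noteq> 0\<^sub>v n" for v
    unfolding hermitian_form_congruence[OF assms(1,2) that(1)]
    using positive_definite_pos[OF assms(5,1)] mult_mat_vec_nonzero[OF assms(2-4) that] assms that by simp
qed (use assms in auto)

lemma positive_definite_add:
  assumes "A \<in> carrier_mat n n" "B \<in> carrier_mat n n" "positive_definite A" "positive_definite B"
  shows "positive_definite (A + B)"
proof (rule positive_definiteI[where n = n])
  show "0 < Re (((A + B) *\<^sub>v v) \<bullet>c v)" if v: "v \<in> carrier_vec n" "v \<noteq> 0\<^sub>v n" for v
    using positive_definite_pos[OF assms(3,1) v] positive_definite_pos[OF assms(4,2) v] assms v
    by (simp add: add_mult_distrib_mat_vec[of _ n n] add_scalar_prod_distrib[of _ n])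
qed (use assms positive_definite_adjoint in \<open>auto simp: mat_adjoint_add[of _ n n]\<close>)

lemma positive_definite_one: "positive_definite (1\<^sub>m n)"
  by (rule positive_definiteI[where n = n]) (auto simp: cscalar_self_pos)

lemma quadratic_form_real_diag:
  assumes "v \<in> carrier_vec n"
  shows "Re ((real_diag n d *\<^sub>v v) \<bullet>c v) = (\<Sum>i<n. d i * (cmod (v $ i))\<^sup>2)"
proof -
  have "(real_diag n d *\<^sub>v v) $ i = d i * v $ i" if "i < n" for i
  proof -
    have "(real_diag n d *\<^sub>v v) $ i = (\<Sum>j\<in>{0..<n}. (if i = j then complex_of_real (d i) else 0) * v $ j)"
      using assms that by (simp add: real_diag_def scalar_prod_def)
    also have "\<dots> = (\<Sum>j\<in>{0..<n}. if j = i then complex_of_real (d i) * v $ i else 0)"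
      by (intro sum.cong) auto
    finally show ?thesis using that by simp
  qed
  then have "(real_diag n d *\<^sub>v v) \<bullet>c v = (\<Sum>i<n. d i * (v $ i * cnj (v $ i)))"
    using assms by (simp add: scalar_prod_def lessThan_atLeast0 mult_ac del: index_mult_mat_vec)
  also have "\<dots> = complex_of_real (\<Sum>i<n. d i * (cmod (v $ i))\<^sup>2)"
    by (simp add: complex_norm_square del: of_real_power)
  finally show ?thesis by simp
qed

lemma positive_definite_real_diag:
  assumes "\<And>i. i < n \<Longrightarrow> 0 < d i"
  shows "positive_definite (real_diag n d)"
proof (rule positive_definiteI[where n = n])
  fix v :: "complex vec" assume v: "v \<in> carrier_vec n" "v \<noteq> 0\<^sub>v n"
  then obtain i where "i < n" "v $ i \<noteq> 0" by (metis carrier_vecD eq_vecI index_zero_vec)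
  then have "0 < (\<Sum>i<n. d i * (cmod (v $ i))\<^sup>2)"
    using assms by (intro sum_pos2[of _ i]) (auto simp: less_imp_le)
  then show "0 < Re ((real_diag n d *\<^sub>v v) \<bullet>c v)" using quadratic_form_real_diag[OF v(1)] by simp
qed auto

lemma positive_definite_unitary_diag:
  assumes "unitary n U" "\<And>i. i < n \<Longrightarrow> 0 < d i"
  shows "positive_definite (U * real_diag n d * mat_adjoint U)"
  using positive_definite_congruence[of "real_diag n d" n "mat_adjoint U" U] assms
    positive_definite_real_diag[of n d]
  by (simp add: unitary_def)

lemma unitary_diag_mult:
  assumes "unitary n U"
  shows "(U * real_diag n d * mat_adjoint U) * (U * real_diag n e * mat_adjoint U)
    = U * real_diag n (\<lambda>i. d i * e i) * mat_adjoint U"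
proof -
  have c: "U \<in> carrier_mat n n" using assms by (simp add: unitary_def)
  have "(U * real_diag n d * mat_adjoint U) * (U * real_diag n e * mat_adjoint U)
    = U * real_diag n d * (mat_adjoint U * U) * real_diag n e * mat_adjoint U"
    using c by (simp add: assoc_mult_mat[of _ n n _ n _ n])
  also have "\<dots> = U * (real_diag n d * real_diag n e) * mat_adjoint U"
    using assms c by (simp add: unitary_def assoc_mult_mat[of _ n n _ n _ n])
  finally show ?thesis by (simp add: real_diag_mult)
qed

lemma positive_definite_spectral:
  assumes A: "A \<in> carrier_mat n n" "positive_definite A"
  obtains U d where "unitary n U" "\<And>i. i < n \<Longrightarrow> 0 < d i" "A = U * real_diag n d * mat_adjoint U"
proof -
  obtain U d where U: "unitary n U" and AU: "A = U * real_diag n d * mat_adjoint U"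
    using hermitian_spectral[OF A(1) positive_definite_adjoint[OF A(2)]] by auto
  have c: "U \<in> carrier_mat n n" using U by (simp add: unitary_def)
  have "mat_adjoint U * A * U = (mat_adjoint U * U) * real_diag n d * (mat_adjoint U * U)"
    using c by (simp add: AU assoc_mult_mat[of _ n n _ n _ n])
  also have "\<dots> = real_diag n d" using U by (simp add: unitary_def)
  finally have "positive_definite (real_diag n d)"
    using positive_definite_congruence[OF A(1) c _ _ A(2), of "mat_adjoint U"] U
    by (simp add: unitary_def)
  have "0 < d i" if i: "i < n" for i
  proof -
    have "0 < Re ((real_diag n d *\<^sub>v unit_vec n i) \<bullet>c unit_vec n i)"
      using i \<open>positive_definite (real_diag n d)\<close> by (intro positive_definite_pos[where n = n]) auto
    also have "\<dots> = (\<Sum>k<n. if k = i then d i else 0)"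
      unfolding quadratic_form_real_diag[OF unit_vec_carrier] using i by (intro sum.cong) auto
    finally show ?thesis using i by simp
  qed
  then show ?thesis using that U AU by blast
qed

lemma positive_definite_inverse:
  assumes A: "A \<in> carrier_mat n n" "positive_definite A"
  obtains C where "C \<in> carrier_mat n n" "positive_definite C" "A * C = 1\<^sub>m n" "C * A = 1\<^sub>m n"
proof -
  obtain U d where U: "unitary n U" and d: "\<And>i. i < n \<Longrightarrow> 0 < d i"
    and AU: "A = U * real_diag n d * mat_adjoint U"
    using positive_definite_spectral[OF A] by metis
  have c: "U \<in> carrier_mat n n" using U by (simp add: unitary_def)
  define C where "C = U * real_diag n (\<lambda>i. 1 / d i) * mat_adjoint U"
  have "A * C = U * real_diag n (\<lambda>i. d i * (1 / d i)) * mat_adjoint U"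
    "C * A = U * real_diag n (\<lambda>i. 1 / d i * d i) * mat_adjoint U"
    unfolding AU C_def by (rule unitary_diag_mult[OF U])+
  moreover have "real_diag n (\<lambda>i. d i * (1 / d i)) = 1\<^sub>m n" "real_diag n (\<lambda>i. 1 / d i * d i) = 1\<^sub>m n"
    using d by (auto intro!: real_diag_one) (metis order_less_irrefl)+
  ultimately have "A * C = 1\<^sub>m n" "C * A = 1\<^sub>m n" using U by (simp_all add: unitary_def)
  moreover have "positive_definite C" using U d by (simp add: C_def positive_definite_unitary_diag)
  moreover have "C \<in> carrier_mat n n" using c by (simp add: C_def)
  ultimately show ?thesis using that by blast
qed

lemma positive_definite_root:
  assumes A: "A \<in> carrier_mat n n" "positive_definite A"
  obtains S where "S \<in> carrier_mat n n" "positive_definite S" "S * S = A"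
proof -
  obtain U d where U: "unitary n U" and d: "\<And>i. i < n \<Longrightarrow> 0 < d i"
    and AU: "A = U * real_diag n d * mat_adjoint U"
    using positive_definite_spectral[OF A] by metis
  have c: "U \<in> carrier_mat n n" using U by (simp add: unitary_def)
  define S where "S = U * real_diag n (\<lambda>i. sqrt (d i)) * mat_adjoint U"
  have "real_diag n (\<lambda>i. sqrt (d i) * sqrt (d i)) = real_diag n d"
    using d by (intro eq_matI) (auto simp: real_diag_def less_imp_le simp flip: of_real_mult)
  then have "S * S = A" unfolding S_def AU by (simp add: unitary_diag_mult[OF U])
  moreover have "positive_definite S" using U d by (simp add: S_def positive_definite_unitary_diag)
  moreover have "S \<in> carrier_mat n n" using c by (simp add: S_def)
  ultimately show ?thesis using that by blast
qed

text \<open>The choices made in the definitions of \<open>mat_inv\<close> and \<open>mat_sqrt\<close> are resolved by exhibiting a matrix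
with the right product; that is how the means are computed below.\<close>

lemma mat_inv_eqI:
  assumes "A \<in> carrier_mat n n" "C \<in> carrier_mat n n" "A * C = 1\<^sub>m n" "C * A = 1\<^sub>m n"
  shows "mat_inv A = C"
proof (cases "mat_inverse A")
  case None
  have "A \<in> Units (ring_mat TYPE(complex) n ())"
    using assms by (auto simp: Units_def ring_mat_def)
  then show ?thesis using mat_inverse(1)[OF assms(1) None, of "()"] by simp
next
  case (Some B)
  note B = mat_inverse(2)[OF assms(1) Some]
  have "B = B * (A * C)" using B assms(3) by simp
  also have "\<dots> = (B * A) * C" using B assms(1,2) by (metis assoc_mult_mat)
  finally show ?thesis using B assms(2) Some by (simp add: mat_inv_def)
qed

lemma mult_inverse_cancel:
  fixes X :: "complex mat"
  assumes "X \<in> carrier_mat n n" "Y \<in> carrier_mat n n" "Z \<in> carrier_mat n n" "X * Y = 1\<^sub>m n"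
  shows "X * (Y * Z) = Z"
  using assms assoc_mult_mat[OF assms(1-3)] by simp

lemma mult_mat_unit_vec:
  fixes M :: "'a :: semiring_1 mat"
  assumes "M \<in> carrier_mat m n" "i < n"
  shows "M *\<^sub>v unit_vec n i = col M i"
  using assms by (intro eq_vecI) (auto simp: scalar_prod_right_unit)

lemma conjugate_unit_vec: "conjugate (unit_vec n i :: complex vec) = unit_vec n i"
  by (rule eq_vecI) (auto simp: unit_vec_def)

text \<open>This turns positivity of a quadratic form into positivity of a trace.\<close>

lemma mat_trace_congruence:
  assumes "P \<in> carrier_mat n n" "M \<in> carrier_mat n n"
  shows "mat_trace (mat_adjoint M * P * M) = (\<Sum>i<n. (P *\<^sub>v col M i) \<bullet>c col M i)"
proof -
  have "(mat_adjoint M * P * M) $$ (i, i) = (P *\<^sub>v col M i) \<bullet>c col M i" if i: "i < n" for i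
  proof -
    have c: "mat_adjoint M * P * M \<in> carrier_mat n n" using assms by simp
    have u: "unit_vec n i \<in> carrier_vec n" by simp
    have "(mat_adjoint M * P * M *\<^sub>v unit_vec n i) \<bullet>c unit_vec n i = (mat_adjoint M * P * M) $$ (i, i)"
      using i assms mult_mat_unit_vec[OF c i] by (simp add: conjugate_unit_vec)
    moreover have "M *\<^sub>v unit_vec n i = col M i" using mult_mat_unit_vec[OF assms(2) i] by simp
    ultimately show ?thesis using hermitian_form_congruence[OF assms u] by simp
  qed
  then show ?thesis using assms by (simp add: mat_trace_def)
qed

abbreviation re_trace :: "complex mat \<Rightarrow> real" where
  "re_trace A \<equiv> Re (mat_trace A)"

lemma re_trace_comm:
  "A \<in> carrier_mat n n \<Longrightarrow> B \<in> carrier_mat n n \<Longrightarrow> re_trace (A * B) = re_trace (B * A)"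
  using mat_trace_comm by metis

text \<open>Uniqueness of the root needs no simultaneous diagonalisation. If \<open>T\<^sup>2 = S\<^sup>2\<close> and \<open>E = T - S\<close>, then
\<open>T E + E S = 0\<close>; multiplying by \<open>E\<close> and taking traces gives \<open>tr (E T E) + tr (E S E) = 0\<close>. Both
summands are nonnegative, so both vanish, and since \<open>S\<close> is positive definite every column of \<open>E\<close> is
zero.\<close>

lemma mat_sqrt_eqI:
  assumes S: "S \<in> carrier_mat n n" "positive_definite S" and SA: "S * S = A"
  shows "mat_sqrt A = S"
  unfolding mat_sqrt_def
proof (rule the_equality)
  show "positive_semidefinite S \<and> S * S = A"
    using S SA positive_definite_nonneg[OF S(2,1)]
    by (auto simp: positive_semidefinite_def positive_definite_def)
  fix T assume T: "positive_semidefinite T \<and> T * T = A"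
  have "dim_row T = n" using T S SA by (metis carrier_matD(1) index_mult_mat(2))
  then have Tc: "T \<in> carrier_mat n n" using T
    by (auto simp: positive_semidefinite_def hermitian_mat_def)
  have adj: "mat_adjoint T = T" "mat_adjoint S = S"
    using T positive_definite_adjoint[OF S(2)]
    by (auto simp: positive_semidefinite_def hermitian_mat_def)
  define E where "E = T - S"
  have E: "E \<in> carrier_mat n n" "mat_adjoint E = E"
    using Tc S adj by (auto simp: E_def mat_adjoint_minus[of _ n n])
  have "T * E + E * S = 0\<^sub>m n n"
  proof -
    have "T * E = A - T * S" "E * S = T * S - A"
      using Tc S T SA by (auto simp: E_def mult_minus_distrib_mat[of _ n n] minus_mult_distrib_mat[of _ n n])
    moreover have "(A - T * S) + (T * S - A) = 0\<^sub>m n n"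
      using Tc S SA by (intro eq_matI) auto
    ultimately show ?thesis by simp
  qed
  then have "E * (T * E + E * S) = 0\<^sub>m n n" using E by simp
  then have "mat_trace (E * (T * E + E * S)) = 0" by (simp add: mat_trace_def)
  moreover have "E * (T * E + E * S) = E * T * E + E * (E * S)"
    using E(1) Tc S(1) by (simp add: mult_add_distrib_mat[of _ n n _ n] assoc_mult_mat[of _ n n _ n _ n])
  moreover have "mat_trace (E * (E * S)) = mat_trace (E * S * E)"
    using mat_trace_comm[of E n n "E * S"] E S by simp
  ultimately have "mat_trace (E * T * E) + mat_trace (E * S * E) = 0"
    using E(1) Tc S(1) by (simp add: mat_trace_add[of _ n])
  then have "(\<Sum>i<n. (T *\<^sub>v col E i) \<bullet>c col E i) + (\<Sum>i<n. (S *\<^sub>v col E i) \<bullet>c col E i) = 0"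
    using mat_trace_congruence[of T n E] mat_trace_congruence[of S n E] E Tc S by simp
  then have "Re ((\<Sum>i<n. (T *\<^sub>v col E i) \<bullet>c col E i) + (\<Sum>i<n. (S *\<^sub>v col E i) \<bullet>c col E i)) = 0"
    by simp
  then have sum0: "(\<Sum>i<n. Re ((T *\<^sub>v col E i) \<bullet>c col E i)) + (\<Sum>i<n. Re ((S *\<^sub>v col E i) \<bullet>c col E i)) = 0"
    by simp
  have Ec: "col E i \<in> carrier_vec n" if "i < n" for i using E by auto
  have "0 \<le> (\<Sum>i<n. Re ((T *\<^sub>v col E i) \<bullet>c col E i))"
    using T Tc Ec by (intro sum_nonneg) (auto simp: positive_semidefinite_def)
  moreover have S0: "0 \<le> Re ((S *\<^sub>v col E i) \<bullet>c col E i)" if "i < n" for i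
    using positive_definite_nonneg[OF S(2,1) Ec[OF that]] .
  ultimately have "(\<Sum>i<n. Re ((S *\<^sub>v col E i) \<bullet>c col E i)) = 0"
    using sum0 sum_nonneg[of "{..<n}" "\<lambda>i. Re ((S *\<^sub>v col E i) \<bullet>c col E i)"] by force
  then have "Re ((S *\<^sub>v col E i) \<bullet>c col E i) = 0" if "i < n" for i
    using S0 that sum_nonneg_eq_0_iff[of "{..<n}" "\<lambda>i. Re ((S *\<^sub>v col E i) \<bullet>c col E i)"] by simp
  then have col0: "col E i = 0\<^sub>v n" if "i < n" for i
    using positive_definite_pos[OF S(2,1) Ec[OF that]] that by force
  show "T = S"
  proof (rule eq_matI)
    fix i j assume "i < dim_row S" "j < dim_col S"
    then have ij: "i < n" "j < n" using S by auto
    then have "E $$ (i, j) = 0" using arg_cong[OF col0[of j], of "\<lambda>v. v $ i"] E(1) by simp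
    then show "T $$ (i, j) = S $$ (i, j)" using ij Tc S by (simp add: E_def)
  qed (use Tc S in auto)
qed

lemma mat_sqrt_positive_definite:
  assumes "A \<in> carrier_mat n n" "positive_definite A"
  shows "mat_sqrt A \<in> carrier_mat n n" "positive_definite (mat_sqrt A)" "mat_sqrt A * mat_sqrt A = A"
proof -
  obtain S where "S \<in> carrier_mat n n" "positive_definite S" "S * S = A"
    using positive_definite_root[OF assms] by blast
  then show "mat_sqrt A \<in> carrier_mat n n" "positive_definite (mat_sqrt A)" "mat_sqrt A * mat_sqrt A = A"
    using mat_sqrt_eqI by auto
qed

lemma mat_inv_positive_definite:
  assumes "A \<in> carrier_mat n n" "positive_definite A"
  shows "mat_inv A \<in> carrier_mat n n" "positive_definite (mat_inv A)"
    "A * mat_inv A = 1\<^sub>m n" "mat_inv A * A = 1\<^sub>m n"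
proof -
  obtain C where "C \<in> carrier_mat n n" "positive_definite C" "A * C = 1\<^sub>m n" "C * A = 1\<^sub>m n"
    using positive_definite_inverse[OF assms] by blast
  then show "mat_inv A \<in> carrier_mat n n" "positive_definite (mat_inv A)"
    "A * mat_inv A = 1\<^sub>m n" "mat_inv A * A = 1\<^sub>m n"
    using mat_inv_eqI[OF assms(1)] by auto
qed

section \<open>The weighted arithmetic-geometric mean inequality for traces\<close>

text \<open>With \<open>S\<close> the root of \<open>P\<close>, the trace is that of \<open>(K S)\<^sup>* Q (K S)\<close>.\<close>

lemma re_trace_weighted_nonneg:
  assumes Q: "Q \<in> carrier_mat n n" "positive_definite Q" and P: "P \<in> carrier_mat n n" "positive_definite P"
    and K: "K \<in> carrier_mat n n"
  shows "0 \<le> re_trace (Q * K * P * mat_adjoint K)"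
proof -
  obtain S where S: "S \<in> carrier_mat n n" "positive_definite S" "S * S = P"
    using positive_definite_root[OF P] by blast
  have KS: "mat_adjoint (K * S) = S * mat_adjoint K"
    using K S positive_definite_adjoint[OF S(2)] by (simp add: mat_adjoint_mult[of _ n n _ n])
  have "re_trace (Q * K * P * mat_adjoint K) = re_trace ((Q * (K * S)) * (S * mat_adjoint K))"
    using Q K S by (simp add: assoc_mult_mat[of _ n n _ n _ n] flip: S(3))
  also have "\<dots> = re_trace (mat_adjoint (K * S) * Q * (K * S))"
    using Q K S KS re_trace_comm[of "Q * (K * S)" n "S * mat_adjoint K"]
    by (simp add: assoc_mult_mat[of _ n n _ n _ n])
  also have "\<dots> = (\<Sum>i<n. Re ((Q *\<^sub>v col (K * S) i) \<bullet>c col (K * S) i))"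
    using mat_trace_congruence[of Q n "K * S"] Q K S by simp
  also have "\<dots> \<ge> 0"
    using K S by (intro sum_nonneg positive_definite_nonneg[OF Q(2,1)]) (auto intro!: col_carrier_vec)
  finally show ?thesis .
qed

text \<open>Expand \<open>re_trace_weighted_nonneg\<close> at \<open>K = M - N\<close>; the two mixed terms are complex conjugates of each
other.\<close>

lemma re_trace_weighted_AM_GM:
  assumes Q: "Q \<in> carrier_mat n n" "positive_definite Q" and P: "P \<in> carrier_mat n n" "positive_definite P"
    and M: "M \<in> carrier_mat n n" and N: "N \<in> carrier_mat n n"
  shows "2 * re_trace (Q * M * P * mat_adjoint N)
    \<le> re_trace (Q * M * P * mat_adjoint M) + re_trace (Q * N * P * mat_adjoint N)"
proof -
  note [simp] = assoc_mult_mat[of _ n n _ n _ n]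
  have "Q * (M - N) * P * mat_adjoint (M - N)
    = (Q * M * P * mat_adjoint M - Q * M * P * mat_adjoint N)
      - (Q * N * P * mat_adjoint M - Q * N * P * mat_adjoint N)"
  proof -
    have "Q * (M - N) * P = Q * M * P - Q * N * P"
      using Q P M N by (simp add: minus_mult_distrib_mat[of _ n n _ _ n] mult_minus_distrib_mat[of _ n n _ n])
    moreover have "(Q * M * P - Q * N * P) * (mat_adjoint M - mat_adjoint N)
      = Q * M * P * (mat_adjoint M - mat_adjoint N) - Q * N * P * (mat_adjoint M - mat_adjoint N)"
      using Q P M N by (intro minus_mult_distrib_mat[of _ n n _ _ n]) auto
    moreover have "Q * L * P * (mat_adjoint M - mat_adjoint N)
      = Q * L * P * mat_adjoint M - Q * L * P * mat_adjoint N" if "L \<in> carrier_mat n n" for L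
      using Q P M N that by (intro mult_minus_distrib_mat[of _ n n _ n]) auto
    ultimately show ?thesis using M N by (simp only: mat_adjoint_minus[OF M N])
  qed
  moreover have "mat_trace (Q * N * P * mat_adjoint M) = cnj (mat_trace (Q * M * P * mat_adjoint N))"
  proof -
    have "mat_adjoint (Q * M * P * mat_adjoint N) = N * P * mat_adjoint M * Q"
      using Q P M N positive_definite_adjoint[OF Q(2)] positive_definite_adjoint[OF P(2)]
      by (simp add: mat_adjoint_mult[of _ n n _ n])
    then have "cnj (mat_trace (Q * M * P * mat_adjoint N)) = mat_trace (N * P * mat_adjoint M * Q)"
      using Q P M N by (simp flip: mat_trace_adjoint[of _ n])
    also have "\<dots> = mat_trace (Q * (N * P * mat_adjoint M))"
      using Q P M N by (intro mat_trace_comm[of _ n n]) auto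
    finally show ?thesis using Q P M N by simp
  qed
  moreover have "M - N \<in> carrier_mat n n" by (rule minus_carrier_mat[OF N])
  note re_trace_weighted_nonneg[OF Q P this]
  ultimately show ?thesis using Q P M N by (simp add: mat_trace_minus[of _ n] minus_carrier_mat[of _ n n])
qed

section \<open>Schatten norms of positive definite matrices\<close>

lemma mat_trace_unitary_diag:
  assumes U: "unitary n U"
  shows "mat_trace (U * real_diag n d * mat_adjoint U) = complex_of_real (\<Sum>i<n. d i)"
proof -
  have c: "U \<in> carrier_mat n n" using U by (simp add: unitary_def)
  have "mat_trace (U * real_diag n d * mat_adjoint U) = mat_trace (mat_adjoint U * (U * real_diag n d))"
    using c by (intro mat_trace_comm[of _ n n]) auto
  also have "mat_adjoint U * (U * real_diag n d) = real_diag n d"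
    using U c by (simp add: unitary_def flip: assoc_mult_mat[of _ n n _ n _ n])
  finally show ?thesis by (simp add: mat_trace_def real_diag_def)
qed

text \<open>For \<open>M = U diag(d) U\<^sup>*\<close> the characteristic polynomial of \<open>M\<^sup>* M = U diag(d\<^sup>2) U\<^sup>*\<close> has the roots
\<open>d\<^sub>i\<^sup>2\<close>, so the singular values of \<open>M\<close> are the \<open>d\<^sub>i\<close>.\<close>

lemma schatten_norm_unitary_diag:
  assumes U: "unitary n U" and d: "\<And>i. i < n \<Longrightarrow> 0 < d i"
  shows "schatten_norm p (U * real_diag n d * mat_adjoint U) = (\<Sum>i<n. d i powr p) powr (1 / p)"
proof -
  let ?M = "U * real_diag n d * mat_adjoint U" and ?R = "real_diag n (\<lambda>i. d i * d i)"
  have c: "U \<in> carrier_mat n n" using U by (simp add: unitary_def)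
  have MM: "mat_adjoint ?M * ?M = U * ?R * mat_adjoint U"
    using positive_definite_adjoint[OF positive_definite_unitary_diag[OF U d]] unitary_diag_mult[OF U] by simp
  have "similar_mat_wit (U * ?R * mat_adjoint U) ?R U (mat_adjoint U)"
    using U c by (intro similar_mat_witI[of _ _ n]) (auto simp: unitary_def)
  then have "char_poly (mat_adjoint ?M * ?M) = char_poly ?R"
    unfolding MM by (intro char_poly_similar) (auto simp: similar_mat_def)
  also have "\<dots> = (\<Prod>a\<leftarrow>diag_mat ?R. [:- a, 1:])"
    by (intro char_poly_upper_triangular[of _ n]) (auto simp: real_diag_def)
  also have "diag_mat ?R = map (\<lambda>i. complex_of_real (d i * d i)) [0..<n]"
    by (auto simp: diag_mat_def real_diag_def)
  finally have "proots (char_poly (mat_adjoint ?M * ?M))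
      = proots (prod_list (map (\<lambda>i. [:- complex_of_real (d i * d i), 1:]) [0..<n]))"
    by (simp add: comp_def)
  also have "\<dots> = sum_list (map (\<lambda>i. proots [:- complex_of_real (d i * d i), 1:]) [0..<n])"
  proof -
    have "0 \<notin> set (map (\<lambda>i. [:- complex_of_real (d i * d i), 1:]) [0..<n])" by auto
    from proots_prod_list[OF this] show ?thesis by (simp only: list.map_comp comp_def)
  qed
  also have "\<dots> = image_mset (\<lambda>i. complex_of_real (d i * d i)) (mset [0..<n])"
    by (induction n) auto
  finally have "mset (singular_values ?M) = image_mset (\<lambda>i. sqrt (d i * d i)) (mset [0..<n])"
    by (simp add: singular_values_def image_mset.compositionality comp_def)
  then have "mset (map (\<lambda>s. s powr p) (singular_values ?M)) = mset (map (\<lambda>i. sqrt (d i * d i) powr p) [0..<n])"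
    by (simp add: image_mset.compositionality comp_def)
  then have "(\<Sum>s\<leftarrow>singular_values ?M. s powr p) = (\<Sum>i\<leftarrow>[0..<n]. sqrt (d i * d i) powr p)"
    by (metis sum_mset_sum_list)
  also have "\<dots> = (\<Sum>i<n. d i powr p)"
    unfolding sum_list_distinct_conv_sum_set[OF distinct_upt]
    using d by (intro sum.cong) (auto simp: less_imp_le real_sqrt_mult_self)
  finally show ?thesis by (simp add: schatten_norm_def)
qed

lemma schatten_norm_1_positive_definite:
  assumes M: "M \<in> carrier_mat n n" "positive_definite M"
  shows "schatten_norm 1 M = re_trace M"
proof -
  obtain U d where U: "unitary n U" and d: "\<And>i. i < n \<Longrightarrow> 0 < d i"
    and MU: "M = U * real_diag n d * mat_adjoint U"
    using positive_definite_spectral[OF M] by metis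
  have "(\<Sum>i<n. d i powr 1) = (\<Sum>i<n. d i)" using d by (intro sum.cong) (auto simp: less_imp_le)
  moreover have "0 \<le> (\<Sum>i<n. d i)" using d by (intro sum_nonneg) (auto simp: less_imp_le)
  ultimately show ?thesis
    unfolding MU by (simp add: schatten_norm_unitary_diag[OF U d] mat_trace_unitary_diag[OF U])
qed

lemma schatten_norm_2_positive_definite:
  assumes M: "M \<in> carrier_mat n n" "positive_definite M"
  shows "schatten_norm 2 M = sqrt (re_trace (M * M))"
proof -
  obtain U d where U: "unitary n U" and d: "\<And>i. i < n \<Longrightarrow> 0 < d i"
    and MU: "M = U * real_diag n d * mat_adjoint U"
    using positive_definite_spectral[OF M] by metis
  have "d i powr 2 = d i * d i" if "i < n" for i
    using d[OF that] by (simp add: power2_eq_square)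
  then have "(\<Sum>i<n. d i powr 2) = (\<Sum>i<n. d i * d i)" by (intro sum.cong) auto
  moreover have "0 \<le> (\<Sum>i<n. d i * d i)" by (intro sum_nonneg) auto
  ultimately show ?thesis
    unfolding MU unitary_diag_mult[OF U]
    by (simp add: schatten_norm_unitary_diag[OF U d] mat_trace_unitary_diag[OF U] powr_half_sqrt)
qed

section \<open>Four trace inequalities\<close>

text \<open>The hypotheses describe the normal form of the pair \<open>(A, B)\<close>: \<open>B = D\<^sup>2\<close>, \<open>A = F\<^sup>2 = D X\<^sup>2 D\<close>,
\<open>A \<sharp> B = D X D\<close> and \<open>A \<natural>\<natural> B = F C F\<close>. Products are kept right-nested, so that two words that agree
after cancelling inverses are identified by rewriting, and the proofs only have to name the cyclic
shifts under the trace.\<close>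

context
  fixes n :: nat and D X C F W :: "complex mat"
  assumes carrier: "D \<in> carrier_mat n n" "X \<in> carrier_mat n n" "C \<in> carrier_mat n n"
      "F \<in> carrier_mat n n" "W \<in> carrier_mat n n"
    and pd: "positive_definite D" "positive_definite X" "positive_definite C" "positive_definite F"
    and inverse: "X * C = 1\<^sub>m n" "C * X = 1\<^sub>m n"
    and W_unitary: "mat_adjoint W * W = 1\<^sub>m n"
    and polar: "W * F = X * D"
begin

private abbreviation "V \<equiv> mat_adjoint W"

private lemma adjoints: "mat_adjoint D = D" "mat_adjoint X = X" "mat_adjoint C = C" "mat_adjoint F = F"
  using pd by (auto simp: positive_definite_adjoint)

private lemmas word_simps =
  carrier adjoints assoc_mult_mat[of _ n n _ n _ n] mat_adjoint_mult[of _ n n _ n]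

private lemma cancel:
  assumes "Z \<in> carrier_mat n n"
  shows "X * (C * Z) = Z" "C * (X * Z) = Z" "V * (W * Z) = Z"
  using assms inverse W_unitary carrier
  by (simp_all add: mult_inverse_cancel[of _ n])

private lemma polar_left: "Z \<in> carrier_mat n n \<Longrightarrow> W * (F * Z) = X * (D * Z)"
  using polar assoc_mult_mat[of W n n F n Z n] assoc_mult_mat[of X n n D n Z n] carrier by simp

private lemma polar_adjoint: "F * V = D * X"
  using arg_cong[OF polar, of mat_adjoint] by (simp add: word_simps)

private lemma polar_right: "Z \<in> carrier_mat n n \<Longrightarrow> F * (V * Z) = D * (X * Z)"
  using polar_adjoint assoc_mult_mat[of F n n V n Z n] assoc_mult_mat[of D n n X n Z n] carrier by simp

private lemma F_squared: "F * F = D * (X * (X * D))"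
proof -
  note [simp] = word_simps
  have "F * F = F * (V * (W * F))" by (simp add: cancel)
  then show ?thesis by (simp add: polar_right polar)
qed


private lemma pd_words:
  "positive_definite (D * D)" "positive_definite (D * (D * D))" "positive_definite (D * (X * D))"
  "positive_definite (X * (D * (D * X)))"
proof -
  note [simp] = word_simps
  obtain L where L: "L \<in> carrier_mat n n" "L * D = 1\<^sub>m n"
    using positive_definite_inverse[OF carrier(1) pd(1)] by blast
  show DD: "positive_definite (D * D)"
    using positive_definite_congruence[of "1\<^sub>m n" n D L] L positive_definite_one by simp
  show "positive_definite (D * (D * D))" "positive_definite (D * (X * D))"
    using positive_definite_congruence[of D n D L] positive_definite_congruence[of X n D L] L pd by simp_all
  show "positive_definite (X * (D * (D * X)))"
    using positive_definite_congruence[of "D * D" n X C] DD inverse by simp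
qed

text \<open>In an eigenbasis of \<open>X\<close> with eigenvalues \<open>x\<^sub>i\<close> the claim is a sum of the scalar inequalities
\<open>x\<^sub>i + x\<^sub>j \<le> x\<^sub>i\<^sup>2 / x\<^sub>j + x\<^sub>j\<^sup>2 / x\<^sub>i\<close> with weights \<open>\<bar>d\<^sub>i\<^sub>j\<bar>\<^sup>2\<close>. The gap is the trace of \<open>K\<^sup>* C K\<close> for
the commutator \<open>K = X D - D X\<close>, which is what the mean inequality provides without any basis.\<close>

lemma trace_geometric_le:
  "re_trace (D * (X * D)) \<le> re_trace (F * (C * F))"
proof -
  note [simp] = word_simps
  have "2 * re_trace (D * (D * X)) \<le> re_trace (D * (X * D)) + re_trace (X * (D * (C * (D * X))))"
    using re_trace_weighted_AM_GM[of "1\<^sub>m n" n C "D * X" "X * D"] pd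
    by (simp add: positive_definite_one cancel)
  moreover have "re_trace (D * (D * X)) = re_trace (D * (X * D))"
    using re_trace_comm[of D n "D * X"] by simp
  moreover have "re_trace (X * (D * (C * (D * X)))) = re_trace (F * (C * F))"
    using re_trace_comm[of "X * D" n "C * (D * X)"] re_trace_comm[of F n "C * F"]
    by (simp add: F_squared)
  ultimately show ?thesis by simp
qed

text \<open>This is \<open>tr (A G) \<le> tr (A N)\<close>. The commutator \<open>X D - D X\<close> is used twice, first with outer weight
\<open>X D\<^sup>2 X\<close> and then with outer weight \<open>D X D\<close>: with \<open>e\<^sub>1 = tr (A G)\<close> and \<open>e\<^sub>2 = tr (D\<^sup>2 X D X D X)\<close>
this gives \<open>2 e\<^sub>1 \<le> e\<^sub>2 + tr (A N)\<close> and \<open>2 e\<^sub>2 \<le> e\<^sub>2 + e\<^sub>1\<close>.\<close>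

lemma trace_mult_first_le:
  "re_trace (D * (X * (X * (D * (D * (X * D)))))) \<le> re_trace (D * (X * (X * (D * (F * (C * F))))))"
proof -
  note [simp] = word_simps
  let ?e1 = "re_trace (D * (D * (X * (D * (D * (X * X))))))"
  let ?e2 = "re_trace (D * (D * (X * (D * (X * (D * X))))))"
  have "2 * ?e1 \<le> ?e2 + re_trace (D * (X * (X * (D * (F * (C * F))))))"
  proof -
    have "2 * re_trace (X * (D * (D * (X * (D * (D * X))))))
        \<le> re_trace (X * (D * (D * (X * (D * (X * D))))))
          + re_trace (X * (D * (D * (X * (X * (D * (C * (D * X))))))))"
      using re_trace_weighted_AM_GM[of "X * (D * (D * X))" n C "D * X" "X * D"] pd pd_words
      by (simp add: cancel)
    moreover have "re_trace (X * (D * (D * (X * (D * (D * X)))))) = ?e1"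
      using re_trace_comm[of X n "D * (D * (X * (D * (D * X))))"] by simp
    moreover have "re_trace (X * (D * (D * (X * (D * (X * D)))))) = ?e2"
      using re_trace_comm[of X n "D * (D * (X * (D * (X * D))))"] by simp
    moreover have "re_trace (X * (D * (D * (X * (X * (D * (C * (D * X))))))))
        = re_trace (D * (X * (X * (D * (F * (C * F))))))"
    proof -
      have "re_trace (D * (X * (X * (D * (F * (C * F)))))) = re_trace ((F * F) * (F * (C * F)))"
        by (simp add: F_squared)
      also have "\<dots> = re_trace (F * F * (F * F) * C)"
        using re_trace_comm[of "F * (F * (F * C))" n F] by simp
      also have "\<dots> = re_trace (D * (X * (X * (D * (D * (X * (X * (D * C))))))))"
        by (simp add: F_squared)
      also have "\<dots> = re_trace (X * (D * (D * (X * (X * (D * (C * (D * X))))))))"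
        using re_trace_comm[of "D * X" n "X * (D * (D * (X * (X * (D * C)))))"] by simp
      finally show ?thesis by simp
    qed
    ultimately show ?thesis by simp
  qed
  moreover have "2 * ?e2 \<le> ?e2 + ?e1"
  proof -
    have "2 * re_trace (D * (X * (D * (X * (D * (X * D))))))
        \<le> re_trace (D * (X * (D * (X * (D * (D * X)))))) + re_trace (D * (X * (D * (D * (X * (X * D))))))"
      using re_trace_weighted_AM_GM[of "D * (X * D)" n "1\<^sub>m n" "X * D" "D * X"] pd_words
      by (simp add: positive_definite_one)
    moreover have "re_trace (D * (X * (D * (X * (D * (X * D)))))) = ?e2"
      using re_trace_comm[of "D * (X * (D * (X * (D * X))))" n D] by simp
    moreover have "re_trace (D * (X * (D * (X * (D * (D * X)))))) = ?e2"
      using re_trace_comm[of "D * (X * (D * X))" n "D * (D * X)"] by simp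
    moreover have "re_trace (D * (X * (D * (D * (X * (X * D)))))) = ?e1"
      using re_trace_comm[of "D * X" n "D * (D * (X * (X * D)))"]
        re_trace_comm[of "D * (D * (X * (X * D)))" n "D * X"]
        re_trace_comm[of "D * (X * (D * (D * (X * X))))" n D] by simp
    ultimately show ?thesis by simp
  qed
  moreover have "re_trace (D * (X * (X * (D * (D * (X * D)))))) = ?e1"
    using re_trace_comm[of "D * (X * X)" n "D * (D * (X * D))"]
      re_trace_comm[of "D * (D * X)" n "D * (D * (X * X))"] by simp
  ultimately show ?thesis by simp
qed

text \<open>This is \<open>tr G\<^sup>2 \<le> tr N\<^sup>2\<close>. The Schatten 4-norm of \<open>X\<^sup>a D X\<^sup>c\<close> with \<open>a + c = 1/2\<close> is a log-convex
function of \<open>a\<close> that is symmetric about \<open>1/4\<close>; its fourth power is \<open>tr G\<^sup>2\<close> at \<open>a = 0, 1/2\<close> and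
\<open>tr N\<^sup>2\<close> at \<open>a = 1\<close>. Since \<open>1/2\<close> is the midpoint of \<open>0\<close> and \<open>1\<close>, a single midpoint step suffices, and
it passes through \<open>tr (A B)\<close>: \<open>tr G\<^sup>2 \<le> tr (A B)\<close> and \<open>2 tr (A B) \<le> tr N\<^sup>2 + tr G\<^sup>2\<close>.\<close>

lemma trace_square_geometric_le:
  "re_trace (D * (X * (D * (D * (X * D))))) \<le> re_trace (F * (C * (F * (F * (C * F)))))"
proof -
  note [simp] = word_simps
  let ?g = "re_trace (D * (X * (D * (D * (X * D)))))" and ?ab = "re_trace (D * (X * (X * (D * (D * D)))))"
  have "?g \<le> ?ab"
  proof -
    have "2 * re_trace (D * (D * (X * (D * (D * X)))))
        \<le> re_trace (D * (D * (X * (X * (D * D))))) + re_trace (X * (D * (D * (D * (D * X)))))"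
      using re_trace_weighted_AM_GM[of "1\<^sub>m n" n "1\<^sub>m n" "D * (D * X)" "X * (D * D)"]
      by (simp add: positive_definite_one)
    moreover have "re_trace (D * (D * (X * (D * (D * X))))) = ?g"
      using re_trace_comm[of D n "D * (X * (D * (D * X)))"] by simp
    moreover have "re_trace (D * (D * (X * (X * (D * D))))) = ?ab"
      using re_trace_comm[of D n "D * (X * (X * (D * D)))"] by simp
    moreover have "re_trace (X * (D * (D * (D * (D * X))))) = ?ab"
      using re_trace_comm[of "X * (D * (D * D))" n "D * X"] by simp
    ultimately show ?thesis by simp
  qed
  moreover have "2 * ?ab \<le> re_trace (F * (C * (F * (F * (C * F))))) + ?g"
  proof -
    \<comment> \<open>\<open>F * F\<close> is \<open>A\<close>; the outer and the inner weight are both \<open>C\<close>, because \<open>N\<^sup>2\<close> has the trace of \<open>C A C A\<close>.\<close>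
    have "2 * re_trace (C * (F * (F * (C * (X * (D * (D * X)))))))
        \<le> re_trace (C * (F * (F * (C * (F * F)))))
          + re_trace (C * (X * (D * (D * (X * (C * (X * (D * (D * X)))))))))"
      using re_trace_weighted_AM_GM[of C n C "F * F" "X * (D * (D * X))"] pd
      by simp
    moreover have "re_trace (C * (F * (F * (C * (X * (D * (D * X))))))) = ?ab"
    proof -
      have "re_trace (C * (F * (F * (C * (X * (D * (D * X))))))) = re_trace (C * ((F * F) * (D * (D * X))))"
        by (simp add: cancel)
      also have "\<dots> = re_trace ((F * F) * (D * (D * (X * C))))"
        using re_trace_comm[of C n "(F * F) * (D * (D * X))"] by simp
      also have "\<dots> = ?ab" by (simp add: F_squared inverse)
      finally show ?thesis .
    qed
    moreover have "re_trace (C * (F * (F * (C * (F * F))))) = re_trace (F * (C * (F * (F * (C * F)))))"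
      using re_trace_comm[of "C * (F * (F * (C * F)))" n F] by simp
    moreover have "re_trace (C * (X * (D * (D * (X * (C * (X * (D * (D * X))))))))) = ?g"
      using re_trace_comm[of D n "D * (X * (D * (D * X)))"] by (simp add: cancel)
    ultimately show ?thesis by simp
  qed
  ultimately show ?thesis by simp
qed

text \<open>This is \<open>tr (D\<^sup>2 G) \<le> tr (D\<^sup>3 F)\<close>. Since \<open>F\<close> and \<open>D W F = G\<close> are both positive definite, \<open>D W = G F\<^sup>-\<^sup>1\<close>
has positive eigenvalues \<open>\<lambda>\<close>, and there are eigenvectors \<open>s\<close> with \<open>F = \<Sum> s s\<^sup>*\<close>. Hence the numbers
\<open>a\<^sub>k = Re tr (D\<^sup>3\<^sup>-\<^sup>k (D W)\<^sup>k F) = \<Sum> \<lambda>\<^sup>k (s\<^sup>* D\<^sup>3\<^sup>-\<^sup>k s)\<close> form a convex sequence, and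
\<open>a\<^sub>5 = a\<^sub>3\<close> because \<open>W\<close> is unitary. Convexity at \<open>k = 4\<close> then reads \<open>a\<^sub>4 \<le> a\<^sub>3\<close>, and convexity at
\<open>k = 3, 2, 1\<close> carries the descent back to \<open>a\<^sub>1 \<le> a\<^sub>0\<close>. Each instance of convexity compares a word \<open>Z\<close>
with \<open>W Z\<close> in the mean inequality.\<close>

lemma trace_mult_polar_le:
  "re_trace (D * (D * (D * (X * D)))) \<le> re_trace (D * (D * (D * F)))"
proof -
  note [simp] = word_simps
  let ?a0 = "re_trace (D * (D * (D * F)))"
  let ?a1 = "re_trace (D * (D * (D * (X * D))))"
  let ?a2 = "re_trace (D * (D * (D * (X * (D * V)))))"
  let ?a3 = "re_trace (D * (D * (W * (D * (X * (D * V))))))"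
  let ?a4 = "re_trace (D * (W * (D * (W * (D * (X * (D * V)))))))"
  have "2 * ?a1 \<le> ?a0 + ?a2"
  proof -
    have "2 * re_trace (D * (D * (D * (F * V))))
        \<le> re_trace (D * (D * (D * F))) + re_trace (D * (D * (D * (X * (D * V)))))"
      using re_trace_weighted_AM_GM[of "D * (D * D)" n F "1\<^sub>m n" W] pd pd_words
      by (simp add: polar_left)
    moreover have "re_trace (D * (D * (D * (F * V)))) = re_trace (D * (D * (D * (X * D))))"
      using re_trace_comm[of D n "D * (D * (D * X))"] by (simp add: polar_adjoint)
    ultimately show ?thesis by simp
  qed
  moreover have "2 * ?a2 \<le> ?a1 + ?a3"
    using re_trace_weighted_AM_GM[of "D * D" n "D * (X * D)" "1\<^sub>m n" W] pd_words
    by simp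
  moreover have "2 * ?a3 \<le> ?a2 + ?a4"
  proof -
    have "2 * re_trace (D * (D * (W * (F * (V * (D * V))))))
        \<le> re_trace (D * (D * (W * (F * (V * D)))))
          + re_trace (D * (W * (D * (W * (F * (V * (D * V)))))))"
      using re_trace_weighted_AM_GM[of D n F "D * W" "W * (D * W)"] pd by simp
    moreover have "re_trace (D * (D * (W * (F * (V * D))))) = ?a2"
      using re_trace_comm[of "D * (D * (X * (D * V)))" n D] by (simp add: polar_left)
    ultimately show ?thesis by (simp add: polar_right)
  qed
  moreover have "2 * ?a4 \<le> ?a3 + ?a3"
  proof -
    have "2 * re_trace (D * (W * (D * (X * (D * (V * (D * V)))))))
        \<le> re_trace (D * (W * (D * (X * (D * (V * D))))))
          + re_trace (W * (D * (W * (D * (X * (D * (V * (D * V))))))))"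
      using re_trace_weighted_AM_GM[of "1\<^sub>m n" n "D * (X * D)" "D * W" "W * (D * W)"] pd_words
      by (simp add: positive_definite_one)
    moreover have "re_trace (D * (W * (D * (X * (D * (V * (D * V))))))) = ?a4"
    proof -
      \<comment> \<open>Move the factor \<open>X\<close> to the right by trading \<open>X D = W F\<close> for \<open>F W\<^sup>* = D X\<close>.\<close>
      have "D * (W * (D * (X * (D * (V * (D * V)))))) = D * (W * (D * (W * (F * (V * (D * V))))))"
        by (simp add: polar_left)
      also have "\<dots> = D * (W * (D * (W * (D * (X * (D * V))))))" by (simp add: polar_right)
      finally show ?thesis by simp
    qed
    moreover have "re_trace (D * (W * (D * (X * (D * (V * D)))))) = ?a3"
      using re_trace_comm[of D n "W * (D * (X * (D * (V * D))))"]
       re_trace_comm[of "D * (W * (D * (X * (D * V))))" n D] by simp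
    moreover have "re_trace (W * (D * (W * (D * (X * (D * (V * (D * V)))))))) = ?a3"
      using re_trace_comm[of "W * (D * (W * (D * (X * (D * (V * D))))))" n V]
       re_trace_comm[of "D * (W * (D * (X * (D * V))))" n D] by (simp add: cancel)
    ultimately show ?thesis by simp
  qed
  ultimately show ?thesis by linarith
qed

text \<open>This is \<open>tr (B G) \<le> tr (B N)\<close>. As \<open>N = F C F\<close> and \<open>C X = 1\<close>, comparing \<open>D F\<close> with \<open>D\<^sup>2 X\<close> under the
weight \<open>C\<close> gives \<open>2 tr (D\<^sup>3 F) \<le> tr (B N) + tr (B G)\<close>.\<close>

lemma trace_mult_second_le:
  "re_trace (D * (D * (D * (X * D)))) \<le> re_trace (D * (D * (F * (C * F))))"
proof -
  note [simp] = word_simps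
  have "2 * re_trace (D * (F * (D * D))) \<le> re_trace (D * (F * (C * (F * D)))) + re_trace (D * (D * (X * (D * D))))"
    using re_trace_weighted_AM_GM[of "1\<^sub>m n" n C "D * F" "D * (D * X)"] pd
    by (simp add: positive_definite_one cancel)
  moreover have "re_trace (D * (F * (D * D))) = re_trace (D * (D * (D * F)))"
    using re_trace_comm[of "D * F" n "D * D"] by simp
  moreover have "re_trace (D * (F * (C * (F * D)))) = re_trace (D * (D * (F * (C * F))))"
    using re_trace_comm[of "D * (F * (C * F))" n D] by simp
  moreover have "re_trace (D * (D * (X * (D * D)))) = re_trace (D * (D * (D * (X * D))))"
    using re_trace_comm[of "D * (D * (X * D))" n D] by simp
  ultimately show ?thesis using trace_mult_polar_le by linarith
qed

end

section \<open>The two means\<close>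

text \<open>Here the normal form is established. That \<open>A \<sharp> B = D X D\<close> is uniqueness of roots: with
\<open>K = F\<^sup>-\<^sup>1\<close> the matrix \<open>K D X D K\<close> squares to \<open>K D X (D K\<^sup>2 D) X D K = K D\<^sup>2 K\<close>, because
\<open>D K\<^sup>2 D = C\<^sup>2\<close>. The same cancellation shows that \<open>W = X D K\<close> is unitary.\<close>

lemma means_trace_inequalities:
  assumes A: "A \<in> carrier_mat n n" "positive_definite A" and B: "B \<in> carrier_mat n n" "positive_definite B"
  shows "A \<sharp> B \<in> carrier_mat n n" "positive_definite (A \<sharp> B)"
    and "A \<natural>\<natural> B \<in> carrier_mat n n" "positive_definite (A \<natural>\<natural> B)"
    and "re_trace (A \<sharp> B) \<le> re_trace (A \<natural>\<natural> B)"
    and "re_trace (A * (A \<sharp> B)) \<le> re_trace (A * (A \<natural>\<natural> B))"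
    and "re_trace (B * (A \<sharp> B)) \<le> re_trace (B * (A \<natural>\<natural> B))"
    and "re_trace ((A \<sharp> B) * (A \<sharp> B)) \<le> re_trace ((A \<natural>\<natural> B) * (A \<natural>\<natural> B))"
proof -
  note [simp] = assoc_mult_mat[of _ n n _ n _ n] mat_adjoint_mult[of _ n n _ n]
  define D where "D = mat_sqrt B"
  define F where "F = mat_sqrt A"
  define K where "K = mat_inv F"
  have D: "D \<in> carrier_mat n n" "positive_definite D" "D * D = B"
    unfolding D_def by (rule mat_sqrt_positive_definite[OF B])+
  have F: "F \<in> carrier_mat n n" "positive_definite F" "F * F = A"
    unfolding F_def by (rule mat_sqrt_positive_definite[OF A])+
  have K: "K \<in> carrier_mat n n" "positive_definite K" "F * K = 1\<^sub>m n" "K * F = 1\<^sub>m n"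
    unfolding K_def by (rule mat_inv_positive_definite[OF F(1,2)])+
  have K_cancel: "F * (K * Z) = Z" "K * (F * Z) = Z" if "Z \<in> carrier_mat n n" for Z
    using mult_inverse_cancel[OF F(1) K(1) that K(3)] mult_inverse_cancel[OF K(1) F(1) that K(4)] .
  have inv_A: "mat_inv A = K * K"
    unfolding F(3)[symmetric] using F(1) K by (intro mat_inv_eqI[of _ n]) (auto simp: K_cancel)
  have inv_A_pd: "positive_definite (K * K)"
    using mat_inv_positive_definite[OF A] by (simp add: inv_A)
  obtain L where L: "L \<in> carrier_mat n n" "L * D = 1\<^sub>m n"
    using positive_definite_inverse[OF D(1,2)] by blast
  note adj = positive_definite_adjoint[OF D(2)] positive_definite_adjoint[OF F(2)]
    positive_definite_adjoint[OF K(2)]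
  define P where "P = D * (K * (K * D))"
  have P: "P \<in> carrier_mat n n" "positive_definite P"
    using positive_definite_congruence[of "K * K" n D L] L D K inv_A_pd adj by (simp_all add: P_def)
  define C where "C = mat_sqrt P"
  have C: "C \<in> carrier_mat n n" "positive_definite C" "C * C = P"
    unfolding C_def by (rule mat_sqrt_positive_definite[OF P])+
  define X where "X = mat_inv C"
  have X: "X \<in> carrier_mat n n" "positive_definite X" "C * X = 1\<^sub>m n" "X * C = 1\<^sub>m n"
    unfolding X_def by (rule mat_inv_positive_definite[OF C(1,2)])+
  have X_cancel: "C * (X * Z) = Z" "X * (C * Z) = Z" if "Z \<in> carrier_mat n n" for Z
    using mult_inverse_cancel[OF C(1) X(1) that X(3)] mult_inverse_cancel[OF X(1) C(1) that X(4)] .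
  have XPX: "X * (D * (K * (K * (D * (X * Z))))) = Z" if Z: "Z \<in> carrier_mat n n" for Z
  proof -
    have "X * (D * (K * (K * (D * (X * Z))))) = X * (P * (X * Z))"
      using D(1) K(1) X(1) Z by (simp add: P_def)
    also have "\<dots> = X * (C * (C * (X * Z)))"
      unfolding C(3)[symmetric] using C(1) X(1) Z by simp
    finally show ?thesis using C(1) X(1) Z by (simp add: X_cancel)
  qed
  define W where "W = X * (D * K)"
  have W: "W \<in> carrier_mat n n" using X D K by (simp add: W_def)
  have "W * mat_adjoint W = 1\<^sub>m n"
    using X D K adj positive_definite_adjoint[OF X(2)] XPX[of "1\<^sub>m n"] by (simp add: W_def)
  then have W_unitary: "mat_adjoint W * W = 1\<^sub>m n"
    using mat_mult_left_right_inverse[of W n "mat_adjoint W"] W by simp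
  have polar: "W * F = X * D" using X D K F by (simp add: W_def)

  have N: "A \<natural>\<natural> B = F * (C * F)"
    using F C D K by (simp add: double_natural_mean_def inv_A C_def P_def flip: D_def F_def)
  have DXD_pd: "positive_definite (D * (X * D))"
    using positive_definite_congruence[of X n D L] L D X adj by simp
  have "mat_sqrt (K * (B * K)) = K * (D * (X * (D * K)))"
  proof (rule mat_sqrt_eqI[of _ n])
    show "positive_definite (K * (D * (X * (D * K))))"
      using positive_definite_congruence[of "D * (X * D)" n K F] DXD_pd D X K F adj by simp
    have "K * (D * (X * (D * K))) * (K * (D * (X * (D * K))))
        = K * (D * (X * (D * (K * (K * (D * (X * (D * K))))))))"
      using D X K by simp
    then show "K * (D * (X * (D * K))) * (K * (D * (X * (D * K)))) = K * (B * K)"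
      unfolding D(3)[symmetric] using D(1) X(1) K(1) by (simp add: XPX)
  qed (use D X K in simp)
  then have G: "A \<sharp> B = D * (X * D)"
    using B D X K F by (simp add: geometric_mean_def K_cancel flip: F_def K_def)
  have FF: "D * (X * (X * D)) = A"
  proof -
    have "F * F = F * ((mat_adjoint W * W) * F)" using F W_unitary by simp
    also have "\<dots> = mat_adjoint (W * F) * (W * F)" using F W adj by simp
    also have "\<dots> = D * (X * (X * D))" unfolding polar
      using D X adj positive_definite_adjoint[OF X(2)] by simp
    finally show ?thesis using F by simp
  qed
  note core = D(1) X(1) C(1) F(1) W D(2) X(2) C(2) F(2) X(4,3) W_unitary polar
  show "A \<sharp> B \<in> carrier_mat n n" "positive_definite (A \<sharp> B)"
    using D X DXD_pd by (simp_all add: G)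
  show "A \<natural>\<natural> B \<in> carrier_mat n n" "positive_definite (A \<natural>\<natural> B)"
    using positive_definite_congruence[of C n F K] C F K adj by (simp_all add: N)
  show "re_trace (A \<sharp> B) \<le> re_trace (A \<natural>\<natural> B)"
    using trace_geometric_le[OF core] by (simp add: G N)
  show "re_trace (A * (A \<sharp> B)) \<le> re_trace (A * (A \<natural>\<natural> B))"
    unfolding G N unfolding FF[symmetric] using trace_mult_first_le[OF core] D(1) X(1) C(1) F(1) by simp
  show "re_trace (B * (A \<sharp> B)) \<le> re_trace (B * (A \<natural>\<natural> B))"
    unfolding G N unfolding D(3)[symmetric] using trace_mult_second_le[OF core] D(1) X(1) C(1) F(1) by simp
  show "re_trace ((A \<sharp> B) * (A \<sharp> B)) \<le> re_trace ((A \<natural>\<natural> B) * (A \<natural>\<natural> B))"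
    unfolding G N using trace_square_geometric_le[OF core] D(1) X(1) C(1) F(1) by simp
qed

lemma re_trace_add_square:
  assumes "M \<in> carrier_mat n n" "E \<in> carrier_mat n n"
  shows "re_trace ((M + E) * (M + E)) = re_trace (M * M) + 2 * re_trace (M * E) + re_trace (E * E)"
proof -
  have "(M + E) * (M + E) = (M * M + E * M) + (M * E + E * E)"
    using assms
    by (simp add: add_mult_distrib_mat[of _ n n _ _ n] mult_add_distrib_mat[of _ n n _ n])
  then show ?thesis
    using assms re_trace_comm[of E n M] by (simp add: mat_trace_add[of _ n])
qed

theorem theorem4p2:
  fixes A B :: "complex mat" and n :: nat and p :: real
  assumes "A \<in> carrier_mat n n" and "B \<in> carrier_mat n n"
    and "positive_definite A" and "positive_definite B"
    and "p = 1 \<or> p = 2"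
  shows "schatten_norm p (A + B + A \<sharp> B + A \<natural>\<natural> B)
           \<le> schatten_norm p (A + B + 2 \<cdot>\<^sub>m (A \<natural>\<natural> B))"
proof -
  define G where "G = A \<sharp> B"
  define N where "N = A \<natural>\<natural> B"
  note ineqs = means_trace_inequalities[OF assms(1,3,2,4), folded G_def N_def]
  define M where "M = A + B + G + N"
  define E where "E = N - G"
  have GN: "G \<in> carrier_mat n n" "N \<in> carrier_mat n n" using ineqs by auto
  have c: "M \<in> carrier_mat n n" "E \<in> carrier_mat n n"
    using assms GN by (auto simp: M_def E_def)
  have "A + B + 2 \<cdot>\<^sub>m N = A + B + N + N"
    using assms GN by (intro eq_matI) auto
  moreover have "\<dots> = M + E"
    using assms GN by (intro eq_matI) (auto simp: M_def E_def)
  ultimately have rhs: "A + B + 2 \<cdot>\<^sub>m N = M + E" "M + E = A + B + N + N" by simp_all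
  have pd: "positive_definite M" "positive_definite (M + E)"
    unfolding rhs(2) using assms GN ineqs(2,4)
    by (auto simp: M_def intro!: positive_definite_add[of _ n])
  have "re_trace M \<le> re_trace (M + E)"
    using c GN ineqs(5) by (simp add: mat_trace_add[of _ n] E_def mat_trace_minus[of _ n])
  moreover have "re_trace (M * M) \<le> re_trace ((M + E) * (M + E))"
  proof -
    have ME: "re_trace (M * E) = re_trace (M * N) - re_trace (M * G)"
      using c GN by (simp add: E_def mult_minus_distrib_mat[of _ n n _ n] mat_trace_minus[of _ n])
    have MZ: "re_trace (M * Z) = re_trace (A * Z) + re_trace (B * Z) + re_trace (G * Z) + re_trace (N * Z)"
      if "Z \<in> carrier_mat n n" for Z
      using assms GN that by (simp add: M_def add_mult_distrib_mat[of _ n n _ _ n] mat_trace_add[of _ n])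
    have "0 \<le> re_trace (M * E)"
      unfolding ME MZ[OF GN(1)] MZ[OF GN(2)]
      using ineqs(6-8) re_trace_comm[of G n N] GN by linarith
    moreover have "0 \<le> re_trace (E * E)"
    proof -
      have "mat_adjoint E = E"
        using GN positive_definite_adjoint[OF ineqs(2)] positive_definite_adjoint[OF ineqs(4)]
        by (simp add: E_def mat_adjoint_minus[of _ n n])
      then show ?thesis
        using re_trace_weighted_nonneg[of "1\<^sub>m n" n "1\<^sub>m n" E] c by (simp add: positive_definite_one)
    qed
    ultimately show ?thesis by (simp add: re_trace_add_square[OF c])
  qed
  ultimately show ?thesis
    using assms(5) pd c
    by (auto simp: schatten_norm_1_positive_definite[of _ n] schatten_norm_2_positive_definite[of _ n] rhs(1)
        simp flip: G_def N_def M_def)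
qed

end
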